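(* Let $A,B\in\mathbb{C}^{n\times n}$ be Hermitian and $C=A-B$. Let $\lambda_A$ (resp. $\lambda_B$) be the minimum eigenvalue of $A$ (resp. $B$), let $S_A$ (resp. $S_B$) be a matrix whose columns form an orthonormal basis of the eigenspace of $A$ for $\lambda_A$ (resp. of $B$ for $\lambda_B$), let $\theta_A$ be the minimum eigenvalue of $S_B^HAS_B$ and $\theta_B$ the minimum eigenvalue of $S_A^HBS_A$. Suppose $\lambda_A\le\theta_B$ and $\lambda_B\le\theta_A$. Then $$\max_{\mu\in\mathbb{R}}\lambda_{\min}(A-\mu C)=\max_{\mu\in[0,1]}\lambda_{\min}(A-\mu C).$$ Furthermore, if $\lambda_A<\theta_B$ and $\lambda_B<\theta_A$, then $$\arg\max_{\mu\in\mathbb{R}}\lambda_{\min}(A-\mu C)=\arg\max_{\mu\in(0,1)}\lambda_{\min}(A-\mu C).$$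
   Context: $\lambda_{\min}(M)$ denotes the smallest eigenvalue of a Hermitian matrix $M$. $\arg\max$ denotes the set of maximizers. *)

theory Defs
  imports Jordan_Normal_Form.Schur_Decomposition Jordan_Normal_Form.VS_Connect
begin

definition hermitian_mat :: "complex mat \<Rightarrow> bool" where
  "hermitian_mat M \<longleftrightarrow> mat_adjoint M = M"

text \<open>The spectrum of a Hermitian matrix is real, so ranging over the real eigenvalues
  loses nothing. The minimum is meaningful only for Hermitian matrices of positive dimension.\<close>

definition lambda_min :: "complex mat \<Rightarrow> real" where
  "lambda_min M = Min {r. eigenvalue M (complex_of_real r)}"

definition eigenspace :: "complex mat \<Rightarrow> complex \<Rightarrow> complex vec set" where
  "eigenspace M c = {v \<in> carrier_vec (dim_row M). M *\<^sub>v v = c \<cdot>\<^sub>v v}"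

text \<open>The number of columns is not prescribed. Linear independence follows from
  orthonormality, so spanning is the only further condition for a basis.\<close>

definition orthonormal_basis_cols :: "nat \<Rightarrow> complex mat \<Rightarrow> complex vec set \<Rightarrow> bool" where
  "orthonormal_basis_cols n S V \<longleftrightarrow>
     dim_row S = n \<and>
     (\<forall>i < dim_col S. \<forall>j < dim_col S. col S i \<bullet>c col S j = (if i = j then 1 else 0)) \<and>
     vec_space.col_space n S = V"

text \<open>A relation rather than a value, so that it includes attainment of the maximum.\<close>

definition is_max_of :: "(real \<Rightarrow> real) \<Rightarrow> real set \<Rightarrow> real \<Rightarrow> bool" where
  "is_max_of f X m \<longleftrightarrow> m \<in> f ` X \<and> (\<forall>x\<in>X. f x \<le> m)"

definition argmax_on :: "(real \<Rightarrow> real) \<Rightarrow> real set \<Rightarrow> real set" where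
  "argmax_on f X = {x. is_arg_max f (\<lambda>y. y \<in> X) x}"

end

theory Submission
  imports Defs
begin

text \<open>Write \<open>f \<mu> = \<lambda>\<^sub>m\<^sub>i\<^sub>n (A - \<mu> C)\<close>; it is the minimum over unit vectors \<open>v\<close> of the
  affine functions \<open>\<mu> \<mapsto> v\<^sup>H A v - \<mu> v\<^sup>H C v\<close>. A unit eigenvector \<open>v\<close> of \<open>A\<close> for its least
  eigenvalue gives such a function with value \<open>f 0\<close> at \<open>0\<close> and slope
  \<open>v\<^sup>H B v - f 0 \<ge> \<theta>\<^sub>B - f 0 \<ge> 0\<close>, hence \<open>f \<mu> \<le> f 0\<close> for \<open>\<mu> \<le> 0\<close>. If all these slopes are
  positive, compactness of the unit sphere gives \<open>f \<mu> > f 0\<close> for some small \<open>\<mu> > 0\<close>. Exchanging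
  \<open>A\<close> with \<open>B\<close> and \<open>\<mu>\<close> with \<open>1 - \<mu>\<close> gives the same at \<open>1\<close>. The Rayleigh characterisation of
  \<open>\<lambda>\<^sub>m\<^sub>i\<^sub>n\<close> needs no spectral theorem: a minimizer \<open>v\<close> of the form with minimum \<open>m\<close> lies in the
  kernel of the positive semidefinite matrix \<open>M - m I\<close>.\<close>

section \<open>Quadratic forms of complex matrices and their adjoints\<close>

text \<open>For Hermitian \<open>M\<close> the number v^H M v is already real, so \<open>Re\<close>
  only makes the form real-valued and hence ordered. With \<open>M\<close> the identity it is the
  squared norm of \<open>v\<close>.\<close>

definition qform :: "complex mat \<Rightarrow> complex vec \<Rightarrow> real" where
  "qform M v = Re ((M *\<^sub>v v) \<bullet>c v)"

lemma qform_eq_sum: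
  assumes "M \<in> carrier_mat n n" "v \<in> carrier_vec n"
  shows "qform M v = Re (\<Sum>i<n. (\<Sum>j<n. M $$ (i,j) * v $ j) * cnj (v $ i))"
  using assms by (simp add: qform_def scalar_prod_def lessThan_atLeast0)

lemma mat_adjoint_carrier [simp]:
  assumes "M \<in> carrier_mat nr nc"
  shows "mat_adjoint M \<in> carrier_mat nc nr"
  using assms by (auto simp: mat_adjoint_def)

lemma mat_adjoint_dim [simp]:
  "dim_row (mat_adjoint M) = dim_col M" "dim_col (mat_adjoint M) = dim_row M"
  by (simp_all add: mat_adjoint_def)

lemma mat_adjoint_index:
  assumes "M \<in> carrier_mat nr nc" "i < nc" "j < nr"
  shows "mat_adjoint M $$ (i,j) = conjugate (M $$ (j,i))"
  using assms by (auto simp: mat_adjoint_def mat_of_rows_def)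

lemma mat_adjoint_adjoint:
  fixes M :: "complex mat"
  assumes "M \<in> carrier_mat nr nc"
  shows "mat_adjoint (mat_adjoint M) = M"
proof (rule eq_matI)
  have M': "mat_adjoint M \<in> carrier_mat nc nr" using assms by simp
  show "dim_row (mat_adjoint (mat_adjoint M)) = dim_row M"
    "dim_col (mat_adjoint (mat_adjoint M)) = dim_col M"
    by simp_all
  fix i j assume "i < dim_row M" "j < dim_col M"
  then show "mat_adjoint (mat_adjoint M) $$ (i,j) = M $$ (i,j)"
    using assms by (simp add: mat_adjoint_index[OF M'] mat_adjoint_index[OF assms])
qed

lemma mat_adjoint_mult:
  fixes X Y :: "complex mat"
  assumes X: "X \<in> carrier_mat a b" and Y: "Y \<in> carrier_mat b c"
  shows "mat_adjoint (X * Y) = mat_adjoint Y * mat_adjoint X"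
proof (rule eq_matI)
  have XY: "X * Y \<in> carrier_mat a c" using X Y by simp
  note c = mat_adjoint_carrier[OF X] mat_adjoint_carrier[OF Y] mat_adjoint_carrier[OF XY]
  show "dim_row (mat_adjoint (X * Y)) = dim_row (mat_adjoint Y * mat_adjoint X)"
    "dim_col (mat_adjoint (X * Y)) = dim_col (mat_adjoint Y * mat_adjoint X)"
    using c by auto
  fix i j assume "i < dim_row (mat_adjoint Y * mat_adjoint X)" "j < dim_col (mat_adjoint Y * mat_adjoint X)"
  then have ij: "i < c" "j < a" using c by auto
  then show "mat_adjoint (X * Y) $$ (i,j) = (mat_adjoint Y * mat_adjoint X) $$ (i,j)"
    using carrier_matD[OF X] carrier_matD[OF Y]
    by (simp add: mat_adjoint_index[OF XY] mat_adjoint_index[OF X]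
        mat_adjoint_index[OF Y] scalar_prod_def mult.commute)
qed

lemma cscalar_prod_adjoint:
  fixes M :: "complex mat"
  assumes M: "M \<in> carrier_mat nr nc" and v: "v \<in> carrier_vec nc" and w: "w \<in> carrier_vec nr"
  shows "(M *\<^sub>v v) \<bullet>c w = v \<bullet>c (mat_adjoint M *\<^sub>v w)"
proof -
  have "(M *\<^sub>v v) \<bullet>c w = (\<Sum>i<nr. \<Sum>j<nc. M $$ (i,j) * v $ j * cnj (w $ i))"
    using M v w by (simp add: scalar_prod_def lessThan_atLeast0 sum_distrib_right)
  also have "\<dots> = (\<Sum>j<nc. \<Sum>i<nr. M $$ (i,j) * v $ j * cnj (w $ i))"
    by (rule sum.swap)
  also have "\<dots> = (\<Sum>j<nc. v $ j * cnj (\<Sum>i<nr. mat_adjoint M $$ (j,i) * w $ i))"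
    using M by (simp add: mat_adjoint_index[OF M] sum_distrib_left mult_ac)
  also have "\<dots> = v \<bullet>c (mat_adjoint M *\<^sub>v w)"
    using carrier_matD[OF M] v w by (simp add: scalar_prod_def lessThan_atLeast0)
  finally show ?thesis .
qed

lemma hermitian_mat_minus_smult:
  assumes "A \<in> carrier_mat n n" "B \<in> carrier_mat n n" "hermitian_mat A" "hermitian_mat B"
  shows "hermitian_mat (A - complex_of_real t \<cdot>\<^sub>m B)"
  unfolding hermitian_mat_def
proof (rule eq_matI)
  let ?M = "A - complex_of_real t \<cdot>\<^sub>m B"
  have M: "?M \<in> carrier_mat n n" using assms by auto
  show "dim_row (mat_adjoint ?M) = dim_row ?M" "dim_col (mat_adjoint ?M) = dim_col ?M"
    using assms by simp_all
  fix i j assume "i < dim_row ?M" "j < dim_col ?M"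
  then have ij: "i < n" "j < n" using M by auto
  have "conjugate (A $$ (j,i)) = A $$ (i,j)" "conjugate (B $$ (j,i)) = B $$ (i,j)"
    using mat_adjoint_index ij assms unfolding hermitian_mat_def by metis+
  then show "mat_adjoint ?M $$ (i,j) = ?M $$ (i,j)"
    using assms ij by (simp add: mat_adjoint_index[OF M])
qed

lemma hermitian_mat_one: "hermitian_mat (1\<^sub>m n)"
  unfolding hermitian_mat_def
proof (rule eq_matI)
  have M: "1\<^sub>m n \<in> carrier_mat n n" by simp
  show "dim_row (mat_adjoint (1\<^sub>m n :: complex mat)) = dim_row (1\<^sub>m n)"
    "dim_col (mat_adjoint (1\<^sub>m n :: complex mat)) = dim_col (1\<^sub>m n)"
    by simp_all
  fix i j assume "i < dim_row (1\<^sub>m n :: complex mat)" "j < dim_col (1\<^sub>m n :: complex mat)"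
  then show "mat_adjoint (1\<^sub>m n :: complex mat) $$ (i,j) = 1\<^sub>m n $$ (i,j)"
    by (simp add: mat_adjoint_index[OF M])
qed

lemma smult_mat_mult_vec:
  fixes M :: "complex mat"
  assumes "M \<in> carrier_mat nr nc" "v \<in> carrier_vec nc"
  shows "(c \<cdot>\<^sub>m M) *\<^sub>v v = c \<cdot>\<^sub>v (M *\<^sub>v v)"
  using assms by (intro eq_vecI) (auto simp: scalar_prod_def sum_distrib_left mult.assoc)

lemma qform_minus_smult:
  assumes "A \<in> carrier_mat n n" "B \<in> carrier_mat n n" "v \<in> carrier_vec n"
  shows "qform (A - complex_of_real t \<cdot>\<^sub>m B) v = qform A v - t * qform B v"
proof -
  have "(A - complex_of_real t \<cdot>\<^sub>m B) *\<^sub>v v = A *\<^sub>v v - complex_of_real t \<cdot>\<^sub>v (B *\<^sub>v v)"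
    using assms by (subst minus_mult_distrib_mat_vec[of _ n n]) (auto simp: smult_mat_mult_vec)
  then show ?thesis
    using assms by (simp add: qform_def minus_scalar_prod_distrib[of _ n])
qed

lemma qform_smult_vec:
  assumes "M \<in> carrier_mat n n" "v \<in> carrier_vec n"
  shows "qform M (complex_of_real t \<cdot>\<^sub>v v) = t\<^sup>2 * qform M v"
  using assms
  by (simp add: qform_def mult_mat_vec conjugate_smult_vec power2_eq_square mult.assoc)

text \<open>Hermitian symmetry makes the two cross terms complex conjugates of each other, so their
  real parts agree and add up to the factor 2.\<close>

lemma qform_add_smult:
  assumes M: "M \<in> carrier_mat n n" "hermitian_mat M" and v: "v \<in> carrier_vec n" and w: "w \<in> carrier_vec n"
  shows "qform M (v + complex_of_real t \<cdot>\<^sub>v w)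
    = qform M v + 2 * t * Re ((M *\<^sub>v v) \<bullet>c w) + t\<^sup>2 * qform M w"
proof -
  have "(M *\<^sub>v w) \<bullet>c v = w \<bullet>c (M *\<^sub>v v)"
    using cscalar_prod_adjoint[OF M(1) w v] M(2) by (simp add: hermitian_mat_def)
  also have "\<dots> = conjugate (M *\<^sub>v v) \<bullet> conjugate (conjugate w)"
    using M v w by (simp add: comm_scalar_prod[of w n])
  also have "\<dots> = conjugate ((M *\<^sub>v v) \<bullet>c w)"
    using M v w by (intro conjugate_sprod_vec[of _ n, symmetric]) auto
  finally have "Re ((M *\<^sub>v w) \<bullet>c v) = Re ((M *\<^sub>v v) \<bullet>c w)" by simp
  then show ?thesis
    using M(1) v w
    by (simp add: qform_def mult_add_distrib_mat_vec[of _ n n] mult_mat_vec[of _ n n]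
        conjugate_add_vec[of _ n] conjugate_smult_vec add_scalar_prod_distrib[of _ n]
        scalar_prod_add_distrib[of _ n] power2_eq_square algebra_simps)
qed

section \<open>The squared norm as the form of the identity, and unit vectors\<close>

lemma qform_one:
  assumes "v \<in> carrier_vec n"
  shows "qform (1\<^sub>m n) v = Re (v \<bullet>c v)"
  using assms by (simp add: qform_def)

lemma cscalar_prod_self_eq_sum:
  fixes v :: "complex vec"
  assumes "v \<in> carrier_vec n"
  shows "v \<bullet>c v = complex_of_real (\<Sum>i<n. (cmod (v $ i))\<^sup>2)"
  using assms
  by (simp add: scalar_prod_def lessThan_atLeast0 complex_norm_square flip: of_real_power)

lemma qform_one_eq_sum:
  assumes "v \<in> carrier_vec n"
  shows "qform (1\<^sub>m n) v = (\<Sum>i<n. (cmod (v $ i))\<^sup>2)"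
  by (simp only: qform_one[OF assms] cscalar_prod_self_eq_sum[OF assms] Re_complex_of_real)

lemma qform_one_nonneg:
  assumes "v \<in> carrier_vec n"
  shows "qform (1\<^sub>m n) v \<ge> 0"
  using assms by (simp add: qform_one_eq_sum sum_nonneg)

lemma qform_one_eq_0_iff:
  assumes "v \<in> carrier_vec n"
  shows "qform (1\<^sub>m n) v = 0 \<longleftrightarrow> v = 0\<^sub>v n"
proof -
  have "qform (1\<^sub>m n) v = 0 \<longleftrightarrow> v \<bullet>c v = 0"
    unfolding qform_one_eq_sum[OF assms] cscalar_prod_self_eq_sum[OF assms] by (simp only: of_real_eq_0_iff)
  then show ?thesis using assms by simp
qed

text \<open>Normalisation is expressed through a quadratic form, so any limit statement about all
  forms covers the norm as well.\<close>

definition unit_vecs :: "nat \<Rightarrow> complex vec set" where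
  "unit_vecs n = {v \<in> carrier_vec n. qform (1\<^sub>m n) v = 1}"

lemma unit_vecs_carrier: "v \<in> unit_vecs n \<Longrightarrow> v \<in> carrier_vec n"
  by (simp add: unit_vecs_def)

lemma normalize_vec:
  assumes "v \<in> carrier_vec n" "v \<noteq> 0\<^sub>v n"
  shows "complex_of_real (1 / sqrt (qform (1\<^sub>m n) v)) \<cdot>\<^sub>v v \<in> unit_vecs n"
proof -
  have "qform (1\<^sub>m n) v > 0"
    using qform_one_nonneg qform_one_eq_0_iff assms by (metis less_le)
  then show ?thesis
    using assms qform_smult_vec[of "1\<^sub>m n" n v "1 / sqrt (qform (1\<^sub>m n) v)"]
    by (simp add: unit_vecs_def power_divide)
qed

lemma unit_vecs_nonempty:
  assumes "n \<ge> 1"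
  shows "unit_vecs n \<noteq> {}"
proof -
  have "unit_vec n 0 \<in> carrier_vec n" "unit_vec n 0 \<noteq> (0\<^sub>v n :: complex vec)"
    using assms by (auto dest: arg_cong[where f = "\<lambda>v. v $ 0"])
  from normalize_vec[OF this] show ?thesis by blast
qed

section \<open>Sequential compactness of the unit sphere\<close>

text \<open>Bolzano-Weierstrass: a monotone subsequence of a bounded real sequence converges. This
  is used for the real parts and then, along the subsequence found, for the imaginary parts.\<close>

lemma complex_bounded_convergent_subseq:
  fixes z :: "nat \<Rightarrow> complex"
  assumes "\<And>k. cmod (z k) \<le> K"
  shows "\<exists>r a. strict_mono r \<and> (\<lambda>k. z (r k)) \<longlonglongrightarrow> a"
proof -
  have real: "\<exists>r a. strict_mono r \<and> (\<lambda>k. x (r k)) \<longlonglongrightarrow> a" if "\<And>k. \<bar>x k\<bar> \<le> K"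
    for x :: "nat \<Rightarrow> real"
  proof -
    obtain r where r: "strict_mono r" "monoseq (\<lambda>k. x (r k))" using seq_monosub by blast
    moreover have "Bseq (\<lambda>k. x (r k))" using that by (intro BseqI'[of _ K]) simp
    ultimately show ?thesis using Bseq_monoseq_convergent unfolding convergent_def by blast
  qed
  obtain r a where r: "strict_mono r" "(\<lambda>k. Re (z (r k))) \<longlonglongrightarrow> a"
    using real[of "\<lambda>k. Re (z k)"] order_trans[OF abs_Re_le_cmod assms] by blast
  obtain s b where s: "strict_mono s" "(\<lambda>k. Im (z (r (s k)))) \<longlonglongrightarrow> b"
    using real[of "\<lambda>k. Im (z (r k))"] order_trans[OF abs_Im_le_cmod assms] by blast
  have "(\<lambda>k. Re (z (r (s k)))) \<longlonglongrightarrow> a"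
    using LIMSEQ_subseq_LIMSEQ[OF r(2) s(1)] by (simp add: o_def)
  then have "(\<lambda>k. z ((r \<circ> s) k)) \<longlonglongrightarrow> Complex a b"
    using s(2) by (simp add: tendsto_complex_iff)
  with strict_mono_o[OF r(1) s(1)] show ?thesis by blast
qed

text \<open>Subsequences are extracted one coordinate at a time; the earlier coordinates keep their
  limits under further extraction. Doubly indexed families replace vectors so that the induction can
  vary \<open>n\<close>.\<close>

lemma coordinatewise_convergent_subseq:
  fixes X :: "nat \<Rightarrow> nat \<Rightarrow> complex"
  assumes "\<And>k i. i < n \<Longrightarrow> cmod (X k i) \<le> K"
  shows "\<exists>r l. strict_mono r \<and> (\<forall>i<n. (\<lambda>k. X (r k) i) \<longlonglongrightarrow> l i)"
  using assms
proof (induction n)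
  case 0
  show ?case by (rule exI[of _ id]) (simp add: strict_mono_def)
next
  case (Suc n)
  then obtain r l where r: "strict_mono r" and l: "\<forall>i<n. (\<lambda>k. X (r k) i) \<longlonglongrightarrow> l i"
    by force
  obtain a s where s: "strict_mono s" and a: "(\<lambda>k. X (r (s k)) n) \<longlonglongrightarrow> a"
    using complex_bounded_convergent_subseq[of "\<lambda>k. X (r k) n" K] Suc.prems by blast
  have "(\<lambda>k. X ((r \<circ> s) k) i) \<longlonglongrightarrow> (l(n := a)) i" if "i < Suc n" for i
  proof (cases "i = n")
    case True
    then show ?thesis using a by (simp add: o_def)
  next
    case False
    then have "(\<lambda>k. X (r k) i) \<longlonglongrightarrow> l i" using that l by simp
    from LIMSEQ_subseq_LIMSEQ[OF this s] False show ?thesis by (simp add: o_def)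
  qed
  with strict_mono_o[OF r s] show ?case by blast
qed

text \<open>Coordinates of unit vectors are bounded by 1, so some subsequence converges
  coordinatewise, and each form is a polynomial in the coordinates and their conjugates. One
  \<open>r\<close> and one \<open>v\<close> serve all \<open>M\<close> simultaneously; the identity
  matrix shows that the limit is again a unit vector.\<close>

lemma unit_vecs_seq_compact:
  fixes V :: "nat \<Rightarrow> complex vec"
  assumes V: "\<And>k. V k \<in> unit_vecs n"
  obtains r v where "strict_mono r" "v \<in> unit_vecs n"
    "\<And>M. M \<in> carrier_mat n n \<Longrightarrow> (\<lambda>k. qform M (V (r k))) \<longlonglongrightarrow> qform M v"
proof -
  have Vc: "V k \<in> carrier_vec n" for k using V by (rule unit_vecs_carrier)
  have "cmod (V k $ i) \<le> 1" if "i < n" for k i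
  proof -
    have "(cmod (V k $ i))\<^sup>2 \<le> (\<Sum>i<n. (cmod (V k $ i))\<^sup>2)"
      using that by (intro member_le_sum) auto
    also have "\<dots> = 1"
      using V[of k] qform_one_eq_sum[OF Vc[of k]] by (simp add: unit_vecs_def)
    finally show ?thesis by (simp add: power_le_one_iff abs_square_le_1)
  qed
  from coordinatewise_convergent_subseq[of n "\<lambda>k i. V k $ i", OF this]
  obtain r l where r: "strict_mono r" and l: "\<forall>i<n. (\<lambda>k. V (r k) $ i) \<longlonglongrightarrow> l i"
    by auto
  define v where "v = vec n l"
  have v: "v \<in> carrier_vec n" by (simp add: v_def)
  have conv: "(\<lambda>k. qform M (V (r k))) \<longlonglongrightarrow> qform M v" if "M \<in> carrier_mat n n" for M
    unfolding qform_eq_sum[OF that Vc] qform_eq_sum[OF that v]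
    using l by (intro tendsto_intros) (auto simp: v_def)
  have "(\<lambda>k. qform (1\<^sub>m n) (V (r k))) \<longlonglongrightarrow> 1"
    using V by (simp add: unit_vecs_def)
  then have "qform (1\<^sub>m n) v = 1"
    using LIMSEQ_unique[OF conv] by simp
  with v have "v \<in> unit_vecs n" by (simp add: unit_vecs_def)
  with r conv that show ?thesis by blast
qed

text \<open>Unit vectors on which the form exceeds every \<open>k\<close> in absolute value would
  have a subsequence with convergent, hence bounded, values; but \<open>r k\<close> is at least
  \<open>k\<close>, so these values still outgrow every bound.\<close>

lemma qform_bounded_on_unit_vecs:
  assumes M: "M \<in> carrier_mat n n"
  obtains K where "\<And>v. v \<in> unit_vecs n \<Longrightarrow> \<bar>qform M v\<bar> \<le> K"
proof -
  have "\<exists>K. \<forall>v\<in>unit_vecs n. \<bar>qform M v\<bar> \<le> K"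
  proof (rule ccontr)
    assume "\<not> ?thesis"
    then have "\<forall>k::nat. \<exists>v\<in>unit_vecs n. \<bar>qform M v\<bar> > real k"
      by (meson not_le)
    then obtain V where V: "\<And>k. V k \<in> unit_vecs n" and big: "\<And>k. \<bar>qform M (V k)\<bar> > real k"
      by metis
    obtain r v where r: "strict_mono r" and lim: "(\<lambda>k. qform M (V (r k))) \<longlonglongrightarrow> qform M v"
      by (rule unit_vecs_seq_compact[of V n]) (use V M in blast)+
    from lim have "Bseq (\<lambda>k. qform M (V (r k)))"
      by (intro convergent_imp_Bseq convergentI)
    then obtain K where K: "\<And>k. \<bar>qform M (V (r k))\<bar> \<le> K"
      by (auto simp: Bseq_def)
    obtain k :: nat where "K < real k" using reals_Archimedean2 by blast
    moreover have "real k \<le> real (r k)" using seq_suble[OF r] by simp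
    ultimately show False using K[of k] big[of "r k"] by linarith
  qed
  with that show ?thesis by blast
qed

section \<open>Rayleigh characterisation of the least eigenvalue\<close>

text \<open>A minimizing sequence has a subsequence whose forms converge to the form at a unit
  vector, and the limit value is the infimum. Boundedness makes \<open>Inf\<close> a genuine lower
  bound.\<close>

lemma qform_attains_min:
  assumes M: "M \<in> carrier_mat n n" and n: "n \<ge> 1"
  obtains v where "v \<in> unit_vecs n" "\<And>w. w \<in> unit_vecs n \<Longrightarrow> qform M v \<le> qform M w"
proof -
  let ?Q = "qform M ` unit_vecs n"
  obtain K where "\<And>v. v \<in> unit_vecs n \<Longrightarrow> \<bar>qform M v\<bar> \<le> K"
    using qform_bounded_on_unit_vecs[OF M] by blast
  then have bdd: "bdd_below ?Q"
    by (intro bdd_belowI[of _ "-K"]) force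
  have ne: "?Q \<noteq> {}" using unit_vecs_nonempty[OF n] by simp
  have "\<exists>v\<in>unit_vecs n. qform M v < Inf ?Q + inverse (real (Suc k))" for k
  proof -
    have "Inf ?Q < Inf ?Q + inverse (real (Suc k))" by simp
    from cInf_lessD[OF ne this] show ?thesis by blast
  qed
  then obtain V where V: "\<And>k. V k \<in> unit_vecs n"
    and near: "\<And>k. qform M (V k) < Inf ?Q + inverse (real (Suc k))" by metis
  obtain r v where r: "strict_mono r" and v: "v \<in> unit_vecs n"
    and lim: "(\<lambda>k. qform M (V (r k))) \<longlonglongrightarrow> qform M v"
    by (rule unit_vecs_seq_compact[of V n]) (use V M in blast)+
  have "(\<lambda>k. Inf ?Q + inverse (real (Suc (r k)))) \<longlonglongrightarrow> Inf ?Q + 0"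
    using LIMSEQ_subseq_LIMSEQ[OF LIMSEQ_inverse_real_of_nat r]
    by (intro tendsto_intros) (simp add: o_def)
  then have le: "qform M v \<le> Inf ?Q"
    using LIMSEQ_le[OF lim] less_imp_le[OF near] by auto
  have "qform M v \<le> qform M w" if "w \<in> unit_vecs n" for w
    using cInf_lower[OF imageI[OF that] bdd] le by linarith
  with v that show ?thesis by blast
qed

text \<open>Since the form is nonnegative along the line through \<open>v\<close> in direction \<open>M v\<close>,
  its linear term \<open>2 t \<parallel>M v\<parallel>\<^sup>2\<close> must vanish.\<close>

lemma psd_kernel:
  assumes M: "M \<in> carrier_mat n n" "hermitian_mat M"
    and psd: "\<And>w. w \<in> carrier_vec n \<Longrightarrow> qform M w \<ge> 0"
    and v: "v \<in> carrier_vec n" and "qform M v = 0"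
  shows "M *\<^sub>v v = 0\<^sub>v n"
proof -
  define w where "w = M *\<^sub>v v"
  have w: "w \<in> carrier_vec n" using M v by (simp add: w_def)
  define c where "c = qform (1\<^sub>m n) w"
  define q where "q = qform M w"
  have q: "q \<ge> 0" using psd w by (simp add: q_def)
  have c: "c \<ge> 0" using qform_one_nonneg w by (simp add: c_def)
  have line: "2 * t * c + t\<^sup>2 * q \<ge> 0" for t
    using psd[of "v + complex_of_real t \<cdot>\<^sub>v w"] qform_add_smult[OF M v w, of t] v w assms(5)
    by (simp add: c_def q_def w_def[symmetric] qform_one)
  have "c = 0"
  proof (rule ccontr)
    assume "c \<noteq> 0"
    with c have "c > 0" by simp
    \<comment> \<open>For small negative \<open>t\<close> the linear term dominates. The parabola is
      lowest at \<open>- c / q\<close>; replacing \<open>q\<close> by \<open>q + 1\<close> covers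
      \<open>q = 0\<close> and still gives a negative value.\<close>
    have "2 * (- c / (q + 1)) * c + (- c / (q + 1))\<^sup>2 * q = - (c\<^sup>2 * (q + 2)) / (q + 1)\<^sup>2"
      using q by (simp add: power_divide divide_simps) (simp add: algebra_simps power2_eq_square)
    also have "\<dots> < 0" using q \<open>c > 0\<close> by (simp add: divide_neg_pos)
    finally show False using line[of "- c / (q + 1)"] by simp
  qed
  then show ?thesis using qform_one_eq_0_iff[OF w] by (simp add: c_def w_def)
qed

lemma qform_eigenvector:
  assumes "M \<in> carrier_mat n n" "v \<in> carrier_vec n" "M *\<^sub>v v = complex_of_real r \<cdot>\<^sub>v v"
  shows "qform M v = r * qform (1\<^sub>m n) v"
  using assms by (simp add: qform_def)

text \<open>\<open>Min\<close> in \<open>lambda_min\<close> is meaningful only on a finite set; here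
  the set embeds into the roots of the monic characteristic polynomial.\<close>

lemma finite_real_eigenvalues:
  assumes M: "M \<in> carrier_mat n n"
  shows "finite {r. eigenvalue M (complex_of_real r)}"
proof -
  have "monic (char_poly M)" using degree_monic_char_poly[OF M] by simp
  then have "char_poly M \<noteq> 0" by auto
  then have "finite {c. poly (char_poly M) c = 0}" by (rule poly_roots_finite)
  then have "finite (complex_of_real -` {c. poly (char_poly M) c = 0})"
    by (intro finite_vimageI) (auto simp: inj_def)
  then show ?thesis using eigenvalue_root_char_poly[OF M] by (simp add: vimage_def)
qed

text \<open>Both sides scale quadratically, so a nonzero vector can be normalised first. The zero
  vector is written as 0 times itself, and homogeneity makes both sides vanish.\<close>

lemma rayleigh_bound_homogeneous:
  assumes M: "M \<in> carrier_mat n n"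
    and bound: "\<And>u. u \<in> unit_vecs n \<Longrightarrow> m \<le> qform M u" and w: "w \<in> carrier_vec n"
  shows "m * qform (1\<^sub>m n) w \<le> qform M w"
proof (cases "w = 0\<^sub>v n")
  case True
  then have "w = complex_of_real 0 \<cdot>\<^sub>v w" by auto
  then have "qform M w = 0\<^sup>2 * qform M w" "qform (1\<^sub>m n) w = 0\<^sup>2 * qform (1\<^sub>m n) w"
    using qform_smult_vec w M one_carrier_mat by metis+
  then show ?thesis by simp
next
  case False
  let ?s = "qform (1\<^sub>m n) w"
  have s: "?s > 0"
    using qform_one_nonneg qform_one_eq_0_iff w False by (metis less_le)
  have "m \<le> (1 / sqrt ?s)\<^sup>2 * qform M w"
    using bound[OF normalize_vec[OF w False]] qform_smult_vec[OF M w] by metis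
  then show ?thesis using s by (simp add: power_divide field_simps)
qed

text \<open>Equality in the Rayleigh bound puts \<open>v\<close> on the zero set of the positive
  semidefinite form of \<open>M - m I\<close>, hence into its kernel.\<close>

lemma psd_shift_eigenvector:
  assumes M: "M \<in> carrier_mat n n" "hermitian_mat M"
    and bound: "\<And>w. w \<in> carrier_vec n \<Longrightarrow> m * qform (1\<^sub>m n) w \<le> qform M w"
    and v: "v \<in> carrier_vec n" and eq: "qform M v = m * qform (1\<^sub>m n) v"
  shows "M *\<^sub>v v = complex_of_real m \<cdot>\<^sub>v v"
proof -
  let ?N = "M - complex_of_real m \<cdot>\<^sub>m 1\<^sub>m n"
  have N: "?N \<in> carrier_mat n n" "hermitian_mat ?N"
    using M hermitian_mat_minus_smult[OF M(1) _ M(2) hermitian_mat_one] by auto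
  have "?N *\<^sub>v v = 0\<^sub>v n"
    using bound eq M(1) v
    by (intro psd_kernel[OF N _ v]) (simp_all add: qform_minus_smult[of _ n])
  moreover have "?N *\<^sub>v v = M *\<^sub>v v - complex_of_real m \<cdot>\<^sub>v v"
    using M(1) v
    by (subst minus_mult_distrib_mat_vec[of _ n n]) (auto simp: smult_mat_mult_vec)
  ultimately have "(M *\<^sub>v v - complex_of_real m \<cdot>\<^sub>v v) $ i = 0" if "i < n" for i
    using that by simp
  then show ?thesis using M(1) v by (intro eq_vecI) auto
qed

text \<open>The minimum \<open>m\<close> of the form on the sphere is an eigenvalue because a
  minimizer attains equality in the Rayleigh bound. It is the least one: an eigenvector for
  \<open>r\<close>, tested in the same bound, gives \<open>m \<le> r\<close>.\<close>

lemma lambda_min_eigenvector: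
  assumes M: "M \<in> carrier_mat n n" "hermitian_mat M" and n: "n \<ge> 1"
  shows "\<exists>v\<in>unit_vecs n. M *\<^sub>v v = complex_of_real (lambda_min M) \<cdot>\<^sub>v v"
    and lambda_min_le_qform:
      "\<And>w. w \<in> carrier_vec n \<Longrightarrow> lambda_min M * qform (1\<^sub>m n) w \<le> qform M w"
proof -
  obtain v where v: "v \<in> unit_vecs n" and min: "\<And>w. w \<in> unit_vecs n \<Longrightarrow> qform M v \<le> qform M w"
    using qform_attains_min[OF M(1) n] by blast
  define m where "m = qform M v"
  have vc: "v \<in> carrier_vec n" and v1: "qform (1\<^sub>m n) v = 1"
    using v by (auto simp: unit_vecs_def)
  have bound: "m * qform (1\<^sub>m n) w \<le> qform M w" if "w \<in> carrier_vec n" for w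
    using rayleigh_bound_homogeneous[OF M(1) _ that] min by (simp add: m_def)
  have ev: "M *\<^sub>v v = complex_of_real m \<cdot>\<^sub>v v"
    using psd_shift_eigenvector[OF M bound vc] v1 by (simp add: m_def)
  have "lambda_min M = m"
    unfolding lambda_min_def
  proof (rule Min_eqI)
    show "finite {r. eigenvalue M (complex_of_real r)}" by (rule finite_real_eigenvalues[OF M(1)])
    have "v \<noteq> 0\<^sub>v n" using v1 qform_one_eq_0_iff[OF vc] by auto
    then show "m \<in> {r. eigenvalue M (complex_of_real r)}"
      using ev vc M(1) by (auto simp: eigenvalue_def eigenvector_def)
  next
    fix r assume "r \<in> {r. eigenvalue M (complex_of_real r)}"
    then obtain w where w: "w \<in> carrier_vec n" "w \<noteq> 0\<^sub>v n" "M *\<^sub>v w = complex_of_real r \<cdot>\<^sub>v w"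
      using M(1) by (auto simp: eigenvalue_def eigenvector_def)
    have "qform (1\<^sub>m n) w > 0"
      using qform_one_nonneg qform_one_eq_0_iff w by (metis less_le)
    then show "m \<le> r"
      using bound[OF w(1)] qform_eigenvector[OF M(1) w(1,3)] by simp
  qed
  then show "\<exists>v\<in>unit_vecs n. M *\<^sub>v v = complex_of_real (lambda_min M) \<cdot>\<^sub>v v"
    and "\<And>w. w \<in> carrier_vec n \<Longrightarrow> lambda_min M * qform (1\<^sub>m n) w \<le> qform M w"
    using v ev bound by auto
qed

lemma lambda_min_attained:
  assumes M: "M \<in> carrier_mat n n" "hermitian_mat M" and n: "n \<ge> 1"
  obtains v where "v \<in> unit_vecs n" "M *\<^sub>v v = complex_of_real (lambda_min M) \<cdot>\<^sub>v v"
    "qform M v = lambda_min M"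
proof -
  obtain v where v: "v \<in> unit_vecs n" "M *\<^sub>v v = complex_of_real (lambda_min M) \<cdot>\<^sub>v v"
    using lambda_min_eigenvector[OF assms] by blast
  then have "qform M v = lambda_min M"
    using qform_eigenvector[OF M(1)] by (simp add: unit_vecs_def)
  with v that show ?thesis by blast
qed

lemma lambda_min_le_qform_unit:
  assumes "M \<in> carrier_mat n n" "hermitian_mat M" "n \<ge> 1" "v \<in> unit_vecs n"
  shows "lambda_min M \<le> qform M v"
  using lambda_min_le_qform[OF assms(1-3), of v] assms(4) by (simp add: unit_vecs_def)

section \<open>Compression of a form by orthonormal columns\<close>

lemma orthonormal_cols_adjoint_mult:
  fixes S :: "complex mat"
  assumes S: "S \<in> carrier_mat n k"
    and orth: "\<forall>i<k. \<forall>j<k. col S i \<bullet>c col S j = (if i = j then 1 else 0)"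
  shows "mat_adjoint S * S = 1\<^sub>m k"
proof (rule eq_matI)
  note S' = mat_adjoint_carrier[OF S]
  show "dim_row (mat_adjoint S * S) = dim_row (1\<^sub>m k)" "dim_col (mat_adjoint S * S) = dim_col (1\<^sub>m k)"
    using S by simp_all
  fix i j assume "i < dim_row (1\<^sub>m k :: complex mat)" "j < dim_col (1\<^sub>m k :: complex mat)"
  then have ij: "i < k" "j < k" by auto
  have "(mat_adjoint S * S) $$ (i,j) = (\<Sum>l<n. cnj (S $$ (l,i)) * S $$ (l,j))"
    using S S' ij by (simp add: scalar_prod_def lessThan_atLeast0 mat_adjoint_index[OF S])
  also have "\<dots> = col S j \<bullet>c col S i"
    using S ij by (simp add: scalar_prod_def lessThan_atLeast0 mult.commute)
  also have "\<dots> = 1\<^sub>m k $$ (i,j)" using orth ij by auto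
  finally show "(mat_adjoint S * S) $$ (i,j) = 1\<^sub>m k $$ (i,j)" .
qed

lemma qform_compression:
  assumes S: "S \<in> carrier_mat n k" and B: "B \<in> carrier_mat n n" and y: "y \<in> carrier_vec k"
  shows "qform (mat_adjoint S * B * S) y = qform B (S *\<^sub>v y)"
proof -
  note S' = mat_adjoint_carrier[OF S]
  have "(mat_adjoint S * B * S) *\<^sub>v y = (mat_adjoint S * B) *\<^sub>v (S *\<^sub>v y)"
    using S S' B y by (intro assoc_mult_mat_vec) auto
  also have "\<dots> = mat_adjoint S *\<^sub>v (B *\<^sub>v (S *\<^sub>v y))"
    using S S' B y by (intro assoc_mult_mat_vec) auto
  finally have "(mat_adjoint S * B * S) *\<^sub>v y = mat_adjoint S *\<^sub>v (B *\<^sub>v (S *\<^sub>v y))" .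
  then show ?thesis
    using cscalar_prod_adjoint[OF S' _ y, of "B *\<^sub>v (S *\<^sub>v y)"] S B y
    by (simp add: qform_def mat_adjoint_adjoint[OF S])
qed

lemma hermitian_mat_compression:
  assumes S: "S \<in> carrier_mat n k" and B: "B \<in> carrier_mat n n" "hermitian_mat B"
  shows "hermitian_mat (mat_adjoint S * B * S)"
proof -
  note S' = mat_adjoint_carrier[OF S]
  have "mat_adjoint (mat_adjoint S * B * S) = mat_adjoint S * mat_adjoint (mat_adjoint S * B)"
    using S S' B by (intro mat_adjoint_mult) auto
  also have "mat_adjoint (mat_adjoint S * B) = B * S"
    using mat_adjoint_mult[OF S' B(1)] B mat_adjoint_adjoint[OF S] by (simp add: hermitian_mat_def)
  also have "mat_adjoint S * (B * S) = mat_adjoint S * B * S"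
    using assoc_mult_mat[OF S' B(1) S] by simp
  finally show ?thesis by (simp add: hermitian_mat_def)
qed

text \<open>The eigenvector \<open>v\<close> equals \<open>S y\<close> for some \<open>y\<close>,
  and \<open>S\<close> is an isometry, so \<open>y\<close> is a unit vector at which the compressed
  form takes the value \<open>qform B v\<close>. This turns the hypotheses on
  \<open>\<theta>\<^sub>A\<close> and \<open>\<theta>\<^sub>B\<close> into bounds on single
  eigenvectors.\<close>

lemma lambda_min_compression_le:
  assumes S: "orthonormal_basis_cols n S (eigenspace A c)"
    and A: "A \<in> carrier_mat n n"
    and B: "B \<in> carrier_mat n n" "hermitian_mat B"
    and v: "v \<in> unit_vecs n" "A *\<^sub>v v = c \<cdot>\<^sub>v v"
  shows "lambda_min (mat_adjoint S * B * S) \<le> qform B v"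
proof -
  define k where "k = dim_col S"
  have Sc: "S \<in> carrier_mat n k"
    and orth: "\<forall>i<k. \<forall>j<k. col S i \<bullet>c col S j = (if i = j then 1 else 0)"
    and span: "vec_space.col_space n S = eigenspace A c"
    using S by (auto simp: orthonormal_basis_cols_def k_def)
  have "v \<in> eigenspace A c"
    using v A by (auto simp: eigenspace_def unit_vecs_def)
  then obtain y where y: "y \<in> carrier_vec k" "S *\<^sub>v y = v"
    unfolding span[symmetric] vec_space.col_space_eq[OF Sc] using Sc by auto
  note S' = mat_adjoint_carrier[OF Sc]
  have "qform (1\<^sub>m k) y = qform (mat_adjoint S * 1\<^sub>m n * S) y"
    using orthonormal_cols_adjoint_mult[OF Sc orth] right_mult_one_mat[OF S'] by simp
  also have "\<dots> = 1"
    using qform_compression[OF Sc _ y(1), of "1\<^sub>m n"] y(2) v by (simp add: unit_vecs_def)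
  finally have y1: "y \<in> unit_vecs k" using y by (simp add: unit_vecs_def)
  \<comment> \<open>The Rayleigh bound for the compressed matrix requires positive dimension; it
    holds because the eigenspace contains the nonzero vector \<open>v\<close>.\<close>
  have "k \<noteq> 0"
  proof
    assume "k = 0"
    then have "y = 0\<^sub>v k" using y(1) by (intro eq_vecI) auto
    then show False using y1 qform_one_eq_0_iff[OF y(1)] by (simp add: unit_vecs_def)
  qed
  then have "lambda_min (mat_adjoint S * B * S) \<le> qform (mat_adjoint S * B * S) y"
    using mult_carrier_mat[OF mult_carrier_mat[OF S' B(1)] Sc]
    by (intro lambda_min_le_qform_unit[OF _ hermitian_mat_compression[OF Sc B] _ y1]) auto
  then show ?thesis using qform_compression[OF Sc B(1) y(1)] y(2) by simp
qed

section \<open>The least eigenvalue along the matrix pencil\<close>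

text \<open>This is the affine path \<open>(1 - t) A + t B\<close>, running from \<open>A\<close> at
  0 to \<open>B\<close> at 1.\<close>

definition pencil :: "complex mat \<Rightarrow> complex mat \<Rightarrow> real \<Rightarrow> complex mat" where
  "pencil A B t = A - complex_of_real t \<cdot>\<^sub>m (A - B)"

text \<open>The reversal through which everything shown at the endpoint 0 is transferred to the
  endpoint 1.\<close>

lemma pencil_swap:
  assumes "A \<in> carrier_mat n n" "B \<in> carrier_mat n n"
  shows "pencil B A t = pencil A B (1 - t)"
  using assms by (intro eq_matI) (auto simp: pencil_def algebra_simps)

context
  fixes A B :: "complex mat" and n :: nat
  assumes n: "n \<ge> 1"
    and A: "A \<in> carrier_mat n n" "hermitian_mat A"
    and B: "B \<in> carrier_mat n n" "hermitian_mat B"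
begin

lemma pencil_carrier: "pencil A B t \<in> carrier_mat n n"
  using A B by (auto simp: pencil_def)

lemma pencil_0: "pencil A B 0 = A"
  using A B by (intro eq_matI) (auto simp: pencil_def)

lemma diff_carrier: "A - B \<in> carrier_mat n n"
  using A B by auto

lemma pencil_hermitian: "hermitian_mat (pencil A B t)"
proof -
  have "A - B = A - complex_of_real 1 \<cdot>\<^sub>m B" using A B by (intro eq_matI) auto
  then have "hermitian_mat (A - B)"
    using hermitian_mat_minus_smult[OF A(1) B(1) A(2) B(2)] by metis
  then show ?thesis
    unfolding pencil_def using hermitian_mat_minus_smult[OF A(1) diff_carrier A(2)] by blast
qed

lemma qform_diff: "v \<in> carrier_vec n \<Longrightarrow> qform (A - B) v = qform A v - qform B v"
  using A B by (simp add: qform_def minus_mult_distrib_mat_vec[of _ n n] minus_scalar_prod_distrib[of _ n])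

lemma qform_pencil:
  "v \<in> carrier_vec n \<Longrightarrow> qform (pencil A B t) v = qform A v - t * qform (A - B) v"
  unfolding pencil_def by (rule qform_minus_smult[OF A(1) diff_carrier])

lemma lambda_min_pencil_le:
  assumes "v \<in> unit_vecs n"
  shows "lambda_min (pencil A B t) \<le> qform A v - t * qform (A - B) v"
  using lambda_min_le_qform_unit[OF pencil_carrier pencil_hermitian n assms]
    qform_pencil[OF unit_vecs_carrier[OF assms]] by simp

lemma lambda_min_pencil_attained:
  obtains v where "v \<in> unit_vecs n" "lambda_min (pencil A B t) = qform A v - t * qform (A - B) v"
proof -
  obtain v where "v \<in> unit_vecs n" "qform (pencil A B t) v = lambda_min (pencil A B t)"
    by (rule lambda_min_attained[OF pencil_carrier pencil_hermitian n])
  then show ?thesis using that[of v] qform_pencil[OF unit_vecs_carrier] by simp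
qed

text \<open>A minimizer for \<open>t\<close> serves as test vector for \<open>s\<close>, so the
  values differ by at most \<open>K * \<bar>s - t\<bar>\<close>, where \<open>K\<close> bounds all
  slopes on the sphere. Exchanging \<open>s\<close> and \<open>t\<close> gives Lipschitz
  continuity.\<close>

lemma continuous_lambda_min_pencil: "continuous_on UNIV (\<lambda>t. lambda_min (pencil A B t))"
proof -
  obtain K where K: "\<And>v. v \<in> unit_vecs n \<Longrightarrow> \<bar>qform (A - B) v\<bar> \<le> K"
    using qform_bounded_on_unit_vecs[OF diff_carrier] by blast
  have one_sided: "lambda_min (pencil A B s) - lambda_min (pencil A B t) \<le> K * \<bar>s - t\<bar>" for s t
  proof -
    obtain v where v: "v \<in> unit_vecs n"
      and t: "lambda_min (pencil A B t) = qform A v - t * qform (A - B) v"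
      by (rule lambda_min_pencil_attained)
    have "lambda_min (pencil A B s) - lambda_min (pencil A B t) \<le> (t - s) * qform (A - B) v"
      using lambda_min_pencil_le[OF v, of s] t by (simp add: algebra_simps)
    also have "\<dots> \<le> \<bar>t - s\<bar> * \<bar>qform (A - B) v\<bar>" by (metis abs_ge_self abs_mult)
    also have "\<dots> \<le> \<bar>t - s\<bar> * K" by (intro mult_left_mono K v) simp
    finally show ?thesis by (simp add: mult.commute abs_minus_commute)
  qed
  have "isCont (\<lambda>t. lambda_min (pencil A B t)) t" for t
  proof -
    have lim: "((\<lambda>s. K * \<bar>s - t\<bar>) \<longlongrightarrow> 0) (at t)"
      by (auto intro!: tendsto_eq_intros)
    have "\<bar>lambda_min (pencil A B s) - lambda_min (pencil A B t)\<bar> \<le> K * \<bar>s - t\<bar>" for s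
      using one_sided[of s t] one_sided[of t s] by (simp add: abs_minus_commute abs_le_iff)
    then have "((\<lambda>s. \<bar>lambda_min (pencil A B s) - lambda_min (pencil A B t)\<bar>) \<longlongrightarrow> 0) (at t)"
      by (intro tendsto_sandwich[OF _ _ tendsto_const lim] always_eventually) simp_all
    then have "((\<lambda>s. lambda_min (pencil A B s) - lambda_min (pencil A B t)) \<longlongrightarrow> 0) (at t)"
      by (rule tendsto_rabs_zero_cancel)
    then show ?thesis by (simp add: isCont_def LIM_zero_iff)
  qed
  then show ?thesis by (rule continuous_at_imp_continuous_on[OF ballI])
qed

lemma lambda_min_pencil_le_at_0:
  assumes ge: "\<And>v. v \<in> unit_vecs n \<Longrightarrow> A *\<^sub>v v = complex_of_real (lambda_min A) \<cdot>\<^sub>v v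
      \<Longrightarrow> lambda_min A \<le> qform B v"
    and "t \<le> 0"
  shows "lambda_min (pencil A B t) \<le> lambda_min A"
proof -
  obtain v where v: "v \<in> unit_vecs n" "A *\<^sub>v v = complex_of_real (lambda_min A) \<cdot>\<^sub>v v"
    and eq: "qform A v = lambda_min A"
    by (rule lambda_min_attained[OF A n])
  have "lambda_min A \<le> qform B v" using ge v by blast
  then have "t * qform (A - B) v \<ge> 0"
    using eq qform_diff[OF unit_vecs_carrier[OF v(1)]] \<open>t \<le> 0\<close> by (simp add: mult_nonpos_nonpos)
  then show ?thesis using lambda_min_pencil_le[OF v(1), of t] eq by simp
qed

text \<open>If no \<open>t = 1/(k+1)\<close> worked, a limit of unit minimizers \<open>v\<^sub>k\<close> would be an
  eigenvector of \<open>A\<close> for its least eigenvalue violating the hypothesis.\<close>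

lemma lambda_min_pencil_gt_at_0:
  assumes gt: "\<And>v. v \<in> unit_vecs n \<Longrightarrow> A *\<^sub>v v = complex_of_real (lambda_min A) \<cdot>\<^sub>v v
      \<Longrightarrow> lambda_min A < qform B v"
  shows "\<exists>t. lambda_min (pencil A B t) > lambda_min A"
proof (rule ccontr)
  assume "\<not> ?thesis"
  then have le: "lambda_min (pencil A B t) \<le> lambda_min A" for t by (simp add: not_less)
  define \<tau> where "\<tau> k = inverse (real (Suc k))" for k
  have "\<exists>v\<in>unit_vecs n. lambda_min (pencil A B (\<tau> k)) = qform A v - \<tau> k * qform (A - B) v" for k
    by (rule lambda_min_pencil_attained[of "\<tau> k"]) blast
  then obtain V where V: "\<And>k. V k \<in> unit_vecs n"
    and eq: "\<And>k. lambda_min (pencil A B (\<tau> k)) = qform A (V k) - \<tau> k * qform (A - B) (V k)"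
    by metis
  have upper: "qform A (V k) \<le> lambda_min A + \<tau> k * qform (A - B) (V k)" for k
    using eq[of k] le[of "\<tau> k"] by simp
  have lower: "lambda_min A \<le> qform A (V k)" for k
    by (rule lambda_min_le_qform_unit[OF A n V])
  \<comment> \<open>The positive factor \<open>\<tau> k\<close> is cancelled before the limit, so
    the sign of the slope survives although \<open>\<tau> k\<close> tends to 0.\<close>
  have nonneg: "qform (A - B) (V k) \<ge> 0" for k
  proof -
    have "\<tau> k * qform (A - B) (V k) \<ge> 0" using upper[of k] lower[of k] by linarith
    moreover have "\<tau> k > 0" by (simp add: \<tau>_def)
    ultimately show ?thesis by (simp add: zero_le_mult_iff)
  qed
  obtain r v where r: "strict_mono r" and v: "v \<in> unit_vecs n"
    and lim: "\<And>M. M \<in> carrier_mat n n \<Longrightarrow> (\<lambda>k. qform M (V (r k))) \<longlonglongrightarrow> qform M v"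
    by (rule unit_vecs_seq_compact[of V n]) (use V in blast)+
  note limA = lim[OF A(1)] and limC = lim[OF diff_carrier]
  have vc: "v \<in> carrier_vec n" and v1: "qform (1\<^sub>m n) v = 1"
    using v by (auto simp: unit_vecs_def)
  have "(\<lambda>k. \<tau> (r k)) \<longlonglongrightarrow> 0"
    using LIMSEQ_subseq_LIMSEQ[OF LIMSEQ_inverse_real_of_nat r] by (simp add: o_def \<tau>_def)
  then have "(\<lambda>k. lambda_min A + \<tau> (r k) * qform (A - B) (V (r k)))
      \<longlonglongrightarrow> lambda_min A + 0 * qform (A - B) v"
    by (intro tendsto_intros limC)
  then have "qform A v \<le> lambda_min A"
    using LIMSEQ_le[OF limA] upper by auto
  then have eqA: "qform A v = lambda_min A"
    using lambda_min_le_qform_unit[OF A n v] by simp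
  then have "A *\<^sub>v v = complex_of_real (lambda_min A) \<cdot>\<^sub>v v"
    using psd_shift_eigenvector[OF A lambda_min_le_qform[OF A n] vc] v1 by simp
  then have "lambda_min A < qform B v" using gt v by blast
  \<comment> \<open>In the limit this says \<open>qform B v \<le> qform A v\<close>, and the
    right-hand side is \<open>lambda_min A\<close>.\<close>
  moreover have "qform (A - B) v \<ge> 0"
    using LIMSEQ_le_const[OF limC] nonneg by blast
  ultimately show False using qform_diff[OF vc] eqA by simp
qed

end

section \<open>Maximizers over the line and over the unit interval\<close>

theorem theorem7p1:
  fixes n :: nat and A B C S\<^sub>A S\<^sub>B :: "complex mat"
    and lam\<^sub>A lam\<^sub>B \<theta>\<^sub>A \<theta>\<^sub>B :: real
  assumes "n \<ge> 1"
    and "A \<in> carrier_mat n n" and "B \<in> carrier_mat n n"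
    and "hermitian_mat A" and "hermitian_mat B"
    and "C = A - B"
    and "lam\<^sub>A = lambda_min A" and "lam\<^sub>B = lambda_min B"
    and "orthonormal_basis_cols n S\<^sub>A (eigenspace A (complex_of_real lam\<^sub>A))"
    and "orthonormal_basis_cols n S\<^sub>B (eigenspace B (complex_of_real lam\<^sub>B))"
    and "\<theta>\<^sub>A = lambda_min (mat_adjoint S\<^sub>B * A * S\<^sub>B)"
    and "\<theta>\<^sub>B = lambda_min (mat_adjoint S\<^sub>A * B * S\<^sub>A)"
    and "lam\<^sub>A \<le> \<theta>\<^sub>B" and "lam\<^sub>B \<le> \<theta>\<^sub>A"
  shows "(\<exists>m. is_max_of (\<lambda>\<mu>. lambda_min (A - complex_of_real \<mu> \<cdot>\<^sub>m C)) UNIV m \<and>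
              is_max_of (\<lambda>\<mu>. lambda_min (A - complex_of_real \<mu> \<cdot>\<^sub>m C)) {0..1} m) \<and>
         (lam\<^sub>A < \<theta>\<^sub>B \<and> lam\<^sub>B < \<theta>\<^sub>A \<longrightarrow>
            argmax_on (\<lambda>\<mu>. lambda_min (A - complex_of_real \<mu> \<cdot>\<^sub>m C)) UNIV =
            argmax_on (\<lambda>\<mu>. lambda_min (A - complex_of_real \<mu> \<cdot>\<^sub>m C)) {0<..<1})"
proof -
  note n = assms(1) and Ac = assms(2) and Bc = assms(3) and Ah = assms(4) and Bh = assms(5)
  define f where "f t = lambda_min (pencil A B t)" for t
  have f: "(\<lambda>\<mu>. lambda_min (A - complex_of_real \<mu> \<cdot>\<^sub>m C)) = f"
    by (simp add: f_def pencil_def assms(6) fun_eq_iff)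
  have f0: "f 0 = lam\<^sub>A"
    using pencil_0[OF n Ac Ah Bc Bh] assms(7) by (simp add: f_def)
  have swap: "lambda_min (pencil B A t) = f (1 - t)" for t
    using pencil_swap[OF Ac Bc] by (simp add: f_def)
  have f1: "f 1 = lam\<^sub>B"
    using swap[of 0] pencil_0[OF n Bc Bh Ac Ah] assms(8) by simp
  have \<theta>B: "\<theta>\<^sub>B \<le> qform B v"
    if "v \<in> unit_vecs n" "A *\<^sub>v v = complex_of_real (lambda_min A) \<cdot>\<^sub>v v" for v
    using lambda_min_compression_le[OF assms(9) Ac Bc Bh] that assms(7,12) by simp
  have \<theta>A: "\<theta>\<^sub>A \<le> qform A v"
    if "v \<in> unit_vecs n" "B *\<^sub>v v = complex_of_real (lambda_min B) \<cdot>\<^sub>v v" for v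
    using lambda_min_compression_le[OF assms(10) Bc Ac Ah] that assms(8,11) by simp
  have left: "f t \<le> f 0" if "t \<le> 0" for t
    using lambda_min_pencil_le_at_0[OF n Ac Ah Bc Bh _ that] \<theta>B assms(7,13) f0
    by (force simp: f_def)
  \<comment> \<open>The reversed pencil is evaluated at \<open>1 - t\<close>, which is at most 0, so
    the bound at its left endpoint applies.\<close>
  have right: "f t \<le> f 1" if "t \<ge> 1" for t
  proof -
    have "lambda_min (pencil B A (1 - t)) \<le> lambda_min B"
      using that \<theta>A assms(8,14) by (intro lambda_min_pencil_le_at_0[OF n Bc Bh Ac Ah]) force+
    then show ?thesis using swap[of "1 - t"] f1 assms(8) by simp
  qed
  have "continuous_on {0..1} f"
    unfolding f_def
    by (rule continuous_on_subset[OF continuous_lambda_min_pencil[OF n Ac Ah Bc Bh]]) simp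
  then obtain x where x: "x \<in> {0..1}" and x_max: "\<And>t. t \<in> {0..1} \<Longrightarrow> f t \<le> f x"
    using continuous_attains_sup[of "{0..1::real}" f] by auto
  have x_glob: "f t \<le> f x" for t
  proof -
    consider "t \<le> 0" | "t \<in> {0..1}" | "t \<ge> 1" by fastforce
    then show ?thesis
      using left right x_max[of t] x_max[of 0] x_max[of 1] by cases force+
  qed
  have "argmax_on f UNIV = argmax_on f {0<..<1}" if "lam\<^sub>A < \<theta>\<^sub>B" "lam\<^sub>B < \<theta>\<^sub>A"
  proof -
    \<comment> \<open>The location of this \<open>t\<close> is irrelevant: \<open>x\<close> is a
      global maximizer, so \<open>f x\<close> exceeds \<open>f 0\<close> as well. The same argument
      with the reversed pencil handles \<open>f 1\<close>.\<close>
    have "\<exists>t. f t > f 0"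
      using lambda_min_pencil_gt_at_0[OF n Ac Ah Bc Bh] \<theta>B that assms(7) f0 by (force simp: f_def)
    then have x0: "f x > f 0" using x_glob by (meson less_le_trans)
    have "\<exists>t. lambda_min (pencil B A t) > lambda_min B"
      using \<theta>A that assms(8) by (intro lambda_min_pencil_gt_at_0[OF n Bc Bh Ac Ah]) force
    then have x1: "f x > f 1" using swap x_glob f1 assms(8) by (metis less_le_trans)
    have inner: "t \<in> {0<..<1}" if "f t = f x" for t
      using that left[of t] right[of t] x0 x1
      by (metis greaterThanLessThan_iff not_le)
    have "is_arg_max f (\<lambda>t. t \<in> UNIV) t \<longleftrightarrow> f t = f x" for t
      using x_glob by (auto simp: is_arg_max_def not_less intro: antisym)
    \<comment> \<open>Although the interval is open, its maximum is attained: by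
      \<open>inner\<close>, \<open>x\<close> itself lies in it, so a maximizer there must reach the
      value \<open>f x\<close>.\<close>
    moreover have "is_arg_max f (\<lambda>t. t \<in> {0<..<1}) t \<longleftrightarrow> f t = f x" for t
      using x_glob inner[of x] inner[of t] unfolding is_arg_max_def
      by (metis not_less antisym)
    ultimately show ?thesis by (simp add: argmax_on_def)
  qed
  moreover have "is_max_of f UNIV (f x)" "is_max_of f {0..1} (f x)"
    using x x_glob by (auto simp: is_max_of_def)
  ultimately show ?thesis unfolding f by blast
qed

end
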